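(* Let $Z$ be a set, let $\vec{A} = (A_i: i<\omega)$ be a $Z$-computable sequence of subsets of $\omega$, and let $(B_i: i<\omega)$ be a sequence of sets such that no $B_i$ is $\Sigma^0_1$ relative to $Z$. Then there exists an $\vec{A}$-cohesive set $C$ such that no $B_i$ is $\Sigma^0_1$ relative to $Z \oplus C$. Consequently, $\mathsf{COH}$ admits preservation of $\Delta^0_2$-definitions: for every $Z$ and every $Z$-computable sequence $\vec A$ there is an $\vec A$-cohesive set $C$ that preserves $\Delta^0_2$-definitions relative to $Z$.
   Context: An $\vec{A}$-cohesive set is an infinite set $C\subseteq\omega$ such that for each $n$, either $C - A_n$ is finite or $C \cap A_n$ is finite. $\mathsf{COH}$ asserts that every sequence of sets has a cohesive set. A set is properly $\Delta^0_2$ relative to $X$ if it is $\Delta^0_2$ relative to $X$ but neither $\Sigma^0_1$ nor $\Pi^0_1$ relative to $X$. A set $Y$ preserves $\Delta^0_2$-definitions relative to $X$ if every set that is properly $\Delta^0_2$ relative to $X$ is properly $\Delta^0_2$ relative to $X \oplus Y$. *)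

theory Defs
  imports Main
begin

text \<open>
  Computability relative to an oracle set, via Kleene's \<open>\<mu>\<close>-recursive functions with the
  characteristic function of the oracle as an additional initial function.  Programs carry no
  fixed arity: they act on argument lists, and evaluation is simply undefined on lists of
  unsuitable length.
\<close>

datatype prog =
    Zero
  | Succ
  | Proj nat
  | Query
  | Comp prog "prog list"
  | Prec prog prog
  | Mu prog

text \<open>\<open>eval X p xs y\<close>: program \<open>p\<close> with oracle \<open>X\<close> converges on input \<open>xs\<close> with output \<open>y\<close>.\<close>

inductive eval :: "nat set \<Rightarrow> prog \<Rightarrow> nat list \<Rightarrow> nat \<Rightarrow> bool" for X :: "nat set" where
  eval_Zero: "eval X Zero xs 0"
| eval_Succ: "eval X Succ [x] (Suc x)"
| eval_Proj: "i < length xs \<Longrightarrow> eval X (Proj i) xs (xs ! i)"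
| eval_Query: "eval X Query [x] (if x \<in> X then 1 else 0)"
| eval_Comp: "list_all2 (\<lambda>q z. eval X q xs z) qs zs \<Longrightarrow> eval X p zs y \<Longrightarrow> eval X (Comp p qs) xs y"
| eval_Prec_0: "eval X p xs y \<Longrightarrow> eval X (Prec p q) (0 # xs) y"
| eval_Prec_Suc: "eval X (Prec p q) (n # xs) r \<Longrightarrow> eval X q (n # r # xs) y \<Longrightarrow>
    eval X (Prec p q) (Suc n # xs) y"
| eval_Mu: "eval X p (n # xs) 0 \<Longrightarrow> (\<And>m. m < n \<Longrightarrow> \<exists>k. eval X p (m # xs) (Suc k)) \<Longrightarrow>
    eval X (Mu p) xs n"

inductive_cases eval_ZeroE: "eval X Zero xs y"
inductive_cases eval_SuccE: "eval X Succ xs y"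
inductive_cases eval_ProjE: "eval X (Proj i) xs y"
inductive_cases eval_QueryE: "eval X Query xs y"
inductive_cases eval_CompE: "eval X (Comp p qs) xs y"
inductive_cases eval_Prec_0E: "eval X (Prec p q) (0 # xs) y"
inductive_cases eval_Prec_SucE: "eval X (Prec p q) (Suc n # xs) y"
inductive_cases eval_MuE: "eval X (Mu p) xs y"

lemma eval_deterministic: "eval X p xs y \<Longrightarrow> eval X p xs z \<Longrightarrow> y = z"
proof (induction arbitrary: z rule: eval.induct)
  case (eval_Zero xs)
  then show ?case by (rule eval_ZeroE) simp
next
  case (eval_Succ x)
  then show ?case by (rule eval_SuccE) simp
next
  case (eval_Proj i xs)
  from eval_Proj(2) show ?case by (rule eval_ProjE) simp
next
  case (eval_Query x)
  then show ?case by (rule eval_QueryE) simp_all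
next
  case (eval_Comp xs qs zs p y)
  from eval_Comp.prems obtain zs' where
    zs': "list_all2 (\<lambda>q z. eval X q xs z) qs zs'" and z: "eval X p zs' z"
    by (rule eval_CompE)
  have "zs = zs'"
    using eval_Comp.IH(1) zs' by (auto simp: list_all2_conv_all_nth intro!: nth_equalityI)
  with z eval_Comp.IH(2) show ?case by blast
next
  case (eval_Prec_0 p xs y q)
  from eval_Prec_0.prems have "eval X p xs z" by (rule eval_Prec_0E)
  then show ?case by (rule eval_Prec_0.IH)
next
  case (eval_Prec_Suc p q n xs r y)
  from eval_Prec_Suc.prems obtain r' where
    "eval X (Prec p q) (n # xs) r'" and q: "eval X q (n # r' # xs) z"
    by (rule eval_Prec_SucE)
  then have "r = r'" by (intro eval_Prec_Suc.IH(1))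
  with q show ?case by (intro eval_Prec_Suc.IH(2)) simp
next
  case (eval_Mu p n xs)
  from eval_Mu.prems have z: "eval X p (z # xs) 0"
    and below: "\<And>m. m < z \<Longrightarrow> \<exists>k. eval X p (m # xs) (Suc k)"
    by (rule eval_MuE, simp)+
  show ?case
  proof (rule linorder_cases[of n z])
    assume "n < z"
    with below obtain k where "eval X p (n # xs) (Suc k)" by blast
    from eval_Mu.IH(1)[OF this] show ?thesis by simp
  next
    assume "z < n"
    with eval_Mu.IH(2) obtain k where "\<forall>u. eval X p (z # xs) u \<longrightarrow> Suc k = u" by blast
    with z show ?thesis by blast
  qed
qed

definition computable_in :: "nat set \<Rightarrow> nat \<Rightarrow> (nat list \<Rightarrow> bool) \<Rightarrow> bool" where
  "computable_in X k R \<longleftrightarrow>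
    (\<exists>p. \<forall>xs. length xs = k \<longrightarrow> eval X p xs (if R xs then 1 else 0))"

text \<open>A sequence of sets is computable if membership is decidable uniformly in the index.\<close>

definition computable_seq :: "nat set \<Rightarrow> (nat \<Rightarrow> nat set) \<Rightarrow> bool" where
  "computable_seq X A \<longleftrightarrow> computable_in X 2 (\<lambda>xs. xs ! 1 \<in> A (xs ! 0))"

definition Sigma1 :: "nat set \<Rightarrow> nat set \<Rightarrow> bool" where
  "Sigma1 X B \<longleftrightarrow> (\<exists>R. computable_in X 2 R \<and> B = {n. \<exists>a. R [n, a]})"

definition Pi1 :: "nat set \<Rightarrow> nat set \<Rightarrow> bool" where
  "Pi1 X B \<longleftrightarrow> (\<exists>R. computable_in X 2 R \<and> B = {n. \<forall>a. R [n, a]})"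

definition Sigma2 :: "nat set \<Rightarrow> nat set \<Rightarrow> bool" where
  "Sigma2 X B \<longleftrightarrow> (\<exists>R. computable_in X 3 R \<and> B = {n. \<exists>a. \<forall>b. R [n, a, b]})"

definition Pi2 :: "nat set \<Rightarrow> nat set \<Rightarrow> bool" where
  "Pi2 X B \<longleftrightarrow> (\<exists>R. computable_in X 3 R \<and> B = {n. \<forall>a. \<exists>b. R [n, a, b]})"

definition Delta2 :: "nat set \<Rightarrow> nat set \<Rightarrow> bool" where
  "Delta2 X B \<longleftrightarrow> Sigma2 X B \<and> Pi2 X B"

definition properly_Delta2 :: "nat set \<Rightarrow> nat set \<Rightarrow> bool" where
  "properly_Delta2 X B \<longleftrightarrow> Delta2 X B \<and> \<not> Sigma1 X B \<and> \<not> Pi1 X B"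

definition join :: "nat set \<Rightarrow> nat set \<Rightarrow> nat set" (infixr \<open>\<oplus>\<close> 65) where
  "X \<oplus> Y = {2 * n | n. n \<in> X} \<union> {2 * n + 1 | n. n \<in> Y}"

definition preserves_Delta2 :: "nat set \<Rightarrow> nat set \<Rightarrow> bool" where
  "preserves_Delta2 X Y \<longleftrightarrow> (\<forall>B. properly_Delta2 X B \<longrightarrow> properly_Delta2 (X \<oplus> Y) B)"

definition cohesive :: "(nat \<Rightarrow> nat set) \<Rightarrow> nat set \<Rightarrow> bool" where
  "cohesive A C \<longleftrightarrow> infinite C \<and> (\<forall>n. finite (C - A n) \<or> finite (C \<inter> A n))"

end

theory Submission
  imports Defs Complex_Main "HOL-Library.Countable_Set" "HOL-Library.Nat_Bijection"
begin

text \<open>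
  \<open>C\<close> is built by Mathias forcing with conditions \<open>(F, X)\<close>, where \<open>F\<close> is finite and the
  reservoir \<open>X\<close> is infinite and computable in \<open>Z\<close>.  Cohesiveness is obtained by shrinking \<open>X\<close> to
  \<open>X \<inter> A k\<close> or \<open>X - A k\<close>.  To keep \<open>B\<close> from being enumerated by the program \<open>p\<close>, one asks which
  numbers \<open>p\<close> enumerates with oracle \<open>Z \<oplus> (F \<union> E)\<close> for some finite \<open>E \<subseteq> X\<close>.  These numbers form a
  set that is \<open>\<Sigma>\<^sub>1\<close> relative to \<open>Z\<close>, hence different from \<open>B\<close>: either some \<open>E\<close> enumerates a number
  outside \<open>B\<close> and is added to \<open>F\<close>, or some element of \<open>B\<close> is never enumerated and \<open>(F, X)\<close> itself
  works.  No universal machine is needed: by recursion on \<open>p\<close>, each program has a total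
  stage-by-stage approximation that takes a code of the oracle as a further argument.
\<close>

section \<open>Total computable functions\<close>

definition computable :: "nat set \<Rightarrow> nat \<Rightarrow> (nat list \<Rightarrow> nat) \<Rightarrow> bool" where
  "computable X k f \<longleftrightarrow> (\<exists>p. \<forall>xs. length xs = k \<longrightarrow> eval X p xs (f xs))"

lemma computable_in_iff: "computable_in X k R \<longleftrightarrow> computable X k (\<lambda>xs. if R xs then 1 else 0)"
  by (simp add: computable_in_def computable_def)

lemma computable_cong:
  "(\<And>xs. length xs = k \<Longrightarrow> f xs = g xs) \<Longrightarrow> computable X k f \<longleftrightarrow> computable X k g"
  unfolding computable_def by (metis (full_types))

lemma computable_in_cong:
  "(\<And>xs. length xs = k \<Longrightarrow> P xs \<longleftrightarrow> Q xs) \<Longrightarrow> computable_in X k P \<longleftrightarrow> computable_in X k Q"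
  unfolding computable_in_iff by (rule computable_cong) simp

lemma computable_comp:
  assumes f: "computable X (length gs) f" and gs: "\<forall>g\<in>set gs. computable X k g"
  shows "computable X k (\<lambda>xs. f (map (\<lambda>g. g xs) gs))"
proof -
  from f obtain p where p: "\<And>xs. length xs = length gs \<Longrightarrow> eval X p xs (f xs)"
    by (auto simp: computable_def)
  from gs have "\<forall>g\<in>set gs. \<exists>q. \<forall>xs. length xs = k \<longrightarrow> eval X q xs (g xs)"
    by (simp add: computable_def)
  then obtain Q where Q: "\<And>g xs. g \<in> set gs \<Longrightarrow> length xs = k \<Longrightarrow> eval X (Q g) xs (g xs)"
    by metis
  have "eval X (Comp p (map Q gs)) xs (f (map (\<lambda>g. g xs) gs))" if "length xs = k" for xs
    by (rule eval_Comp[where zs = "map (\<lambda>g. g xs) gs"])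
      (use p Q that in \<open>auto simp: list_all2_conv_all_nth\<close>)
  then show ?thesis by (auto simp: computable_def)
qed

lemma computable_nth: "i < k \<Longrightarrow> computable X k (\<lambda>xs. xs ! i)"
  unfolding computable_def by (auto intro!: exI[of _ "Proj i"] eval_Proj)

text \<open>Recursion and quantifiers put new variables at the front of the list and leave the
  parameters behind them. This form substitutes for the front entries and hands over the rest, since
  \<open>drop j xs\<close> is itself a list of projections.\<close>

lemma computable_comp_drop:
  assumes f: "computable X (length gs + k) f"
    and gs: "\<forall>g\<in>set gs. computable X (j + k) g"
  shows "computable X (j + k) (\<lambda>xs. f (map (\<lambda>g. g xs) gs @ drop j xs))"
proof -
  let ?gs = "gs @ map (\<lambda>i xs. xs ! i) [j..<j + k]"
  have "computable X (j + k) (\<lambda>xs. f (map (\<lambda>g. g xs) ?gs))"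
    by (rule computable_comp) (use f gs in \<open>auto intro: computable_nth\<close>)
  moreover have "map (\<lambda>g. g xs) ?gs = map (\<lambda>g. g xs) gs @ drop j xs" if "length xs = j + k" for xs
    using that by (auto intro!: nth_equalityI simp: nth_append)
  ultimately show ?thesis
    by (subst computable_cong[where g = "\<lambda>xs. f (map (\<lambda>g. g xs) ?gs)"]) auto
qed

lemma computable_drop:
  "computable X k f \<Longrightarrow> computable X (j + k) (\<lambda>xs. f (drop j xs))"
  using computable_comp_drop[where gs = "[]"] by simp

lemma computable_unary:
  assumes "computable X 1 (\<lambda>xs. f (xs ! 0))" and "computable X k g"
  shows "computable X k (\<lambda>xs. f (g xs))"
  using computable_comp[where gs = "[g]" and f = "\<lambda>xs. f (xs ! 0)"] assms by simp

text \<open>Mirrors \<open>Prec\<close>, with counter and previous value ahead of the parameters.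
  Later recursions are shown computable through it, without writing programs by hand.\<close>

lemma computable_rec_nat:
  assumes f: "computable X k f"
    and g: "computable X (Suc (Suc k)) (\<lambda>ys. g (ys ! 0) (ys ! 1) (drop 2 ys))"
    and h: "computable X k h"
  shows "computable X k (\<lambda>xs. rec_nat (f xs) (\<lambda>m r. g m r xs) (h xs))"
proof -
  from f obtain p where p: "\<And>xs. length xs = k \<Longrightarrow> eval X p xs (f xs)"
    by (auto simp: computable_def)
  from g obtain q where q: "\<And>xs. length xs = Suc (Suc k) \<Longrightarrow>
      eval X q xs (g (xs ! 0) (xs ! 1) (drop 2 xs))"
    by (auto simp: computable_def)
  have "eval X (Prec p q) (n # xs) (rec_nat (f xs) (\<lambda>m r. g m r xs) n)"
    if "length xs = k" for n xs
  proof (induction n)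
    case 0
    show ?case using eval_Prec_0[OF p[OF that]] by simp
  next
    case (Suc n)
    show ?case
      using eval_Prec_Suc[OF Suc q[of "n # rec_nat (f xs) (\<lambda>m r. g m r xs) n # xs"]] that by simp
  qed
  \<comment> \<open>Here the recursion length is a separate first argument; \<open>h\<close> is
    substituted for it afterwards.\<close>
  then have "computable X (Suc k) (\<lambda>ys. rec_nat (f (drop 1 ys)) (\<lambda>m r. g m r (drop 1 ys)) (ys ! 0))"
    unfolding computable_def by (intro exI[of _ "Prec p q"]) (auto simp: length_Suc_conv)
  with computable_comp_drop[of X "[h]" k "\<lambda>ys. rec_nat (f (drop 1 ys)) (\<lambda>m r. g m r (drop 1 ys)) (ys ! 0)" 0] h show ?thesis by simp
qed

lemma computable_Suc:
  assumes "computable X k f"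
  shows "computable X k (\<lambda>xs. Suc (f xs))"
proof (rule computable_unary[where f = Suc and g = f])
  have "eval X Succ xs (Suc (xs ! 0))" if "length xs = 1" for xs
    using that eval_Succ[of X "xs ! 0"] by (cases xs) auto
  then show "computable X 1 (\<lambda>xs. Suc (xs ! 0))" unfolding computable_def by blast
qed (rule assms)

lemma computable_const: "computable X k (\<lambda>xs. n)"
proof (induction n)
  case 0
  show ?case by (auto simp: computable_def intro!: exI[of _ Zero] eval_Zero)
qed (rule computable_Suc)

lemma computable_pred:
  assumes "computable X k f"
  shows "computable X k (\<lambda>xs. f xs - 1)"
proof -
  have "rec_nat 0 (\<lambda>m r. m) n = n - 1" for n :: nat by (cases n) auto
  with computable_rec_nat[where g = "\<lambda>m r xs. m", OF computable_const[of _ _ 0] computable_nth assms]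
  show ?thesis by simp
qed

section \<open>Definition by cases, Boolean combinations and bounded quantifiers\<close>

text \<open>A recursion of length 0 or 1 makes the choice: it starts at \<open>g xs\<close>, and a
  single step overwrites this with \<open>f xs\<close>.\<close>

lemma computable_if:
  assumes P: "computable_in X k P" and f: "computable X k f" and g: "computable X k g"
  shows "computable X k (\<lambda>xs. if P xs then f xs else g xs)"
proof -
  have "computable X (2 + k) (\<lambda>ys. f (drop 2 ys))" by (rule computable_drop) (rule f)
  then have "computable X k
      (\<lambda>xs. rec_nat (g xs) (\<lambda>m r. f xs) (if P xs then 1 else 0))"
    using P g by (intro computable_rec_nat) (auto simp: computable_in_iff)
  then show ?thesis by (rule computable_cong[THEN iffD1, rotated]) simp
qed

lemma computable_in_if:
  assumes "computable_in X k P" and "computable_in X k Q" and "computable_in X k R"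
  shows "computable_in X k (\<lambda>xs. if P xs then Q xs else R xs)"
  using computable_if[OF assms(1) assms(2,3)[unfolded computable_in_iff]]
  unfolding computable_in_iff by (rule computable_cong[THEN iffD1, rotated]) simp

lemma computable_in_const: "computable_in X k (\<lambda>_. b)"
  unfolding computable_in_iff by (rule computable_const)

lemma computable_in_not:
  assumes "computable_in X k P"
  shows "computable_in X k (\<lambda>xs. \<not> P xs)"
  using computable_in_if[OF assms computable_in_const[of _ _ False] computable_in_const[of _ _ True]]
  by (simp add: if_bool_eq_conj)

lemma computable_in_conj:
  assumes "computable_in X k P" and "computable_in X k Q"
  shows "computable_in X k (\<lambda>xs. P xs \<and> Q xs)"
  using computable_in_if[OF assms computable_in_const[of _ _ False]]
  by (rule computable_in_cong[THEN iffD1, rotated]) auto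

lemma computable_in_disj:
  assumes "computable_in X k P" and "computable_in X k Q"
  shows "computable_in X k (\<lambda>xs. P xs \<or> Q xs)"
  using computable_in_if[OF assms(1) computable_in_const[of _ _ True] assms(2)]
  by (rule computable_in_cong[THEN iffD1, rotated]) auto

lemma computable_in_eq_const:
  assumes "computable X k f"
  shows "computable_in X k (\<lambda>xs. f xs = n)"
proof -
  have zero: "computable_in X k (\<lambda>xs. g xs = 0)" if "computable X k g" for g
  proof -
    have "rec_nat 1 (\<lambda>m r. 0) n = (if n = 0 then 1 else 0 :: nat)" for n by (cases n) auto
    with computable_rec_nat[where g = "\<lambda>m r xs. 0", OF computable_const[of _ _ 1] computable_const that]
    show ?thesis by (simp add: computable_in_iff)
  qed
  show ?thesis using assms
  proof (induction n arbitrary: f)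
    case 0
    then show ?case by (rule zero)
  next
    case (Suc n)
    \<comment> \<open>The predecessor of 0 is 0, so the value 0 must be excluded before passing to
      the predecessor.\<close>
    from computable_in_conj[OF computable_in_not[OF zero[OF Suc.prems]] Suc.IH[OF computable_pred[OF Suc.prems]]]
    show ?case by (rule computable_in_cong[THEN iffD1, rotated]) auto
  qed
qed

lemma computable_in_Bex_less:
  assumes P: "computable_in X (Suc k) (\<lambda>ys. P (ys ! 0) (drop 1 ys))" and h: "computable X k h"
  shows "computable_in X k (\<lambda>xs. \<exists>m<h xs. P m xs)"
proof -
  \<comment> \<open>The value 1 records that a witness has been met, and is kept from then
    on.\<close>
  have rec: "rec_nat 0 (\<lambda>m r. if r = 0 then if P m xs then 1 else 0 else 1) n =
      (if \<exists>m<n. P m xs then 1 else 0 :: nat)" for n xs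
    by (induction n) (auto simp: less_Suc_eq)
  have "computable X (Suc (Suc k)) (\<lambda>ys. if P (ys ! 0) (drop 2 ys) then 1 else 0)"
    using computable_comp_drop[of X "[\<lambda>ys. ys ! 0]" k "\<lambda>ys. if P (ys ! 0) (drop 1 ys) then 1 else 0" 2] P
    by (simp add: computable_in_iff computable_nth)
  then have "computable X k
     (\<lambda>xs. rec_nat 0 (\<lambda>m r. if r = 0 then if P m xs then 1 else 0 else 1) (h xs))"
    by (intro computable_rec_nat computable_const computable_if h
        computable_in_eq_const computable_nth) (auto simp: computable_in_iff)
  then show ?thesis by (simp add: rec computable_in_iff)
qed

section \<open>Parity, halving and codes of finite sets\<close>

lemma computable_in_odd:
  assumes "computable X k h"
  shows "computable_in X k (\<lambda>xs. odd (h xs))"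
proof -
  have rec: "rec_nat 0 (\<lambda>m r. if r = 0 then 1 else 0) n = (if odd n then 1 else 0 :: nat)" for n
    by (induction n) auto
  have "computable X k (\<lambda>xs. rec_nat 0 (\<lambda>m r. if r = 0 then 1 else 0) (h xs))"
    by (intro computable_rec_nat computable_const computable_if assms computable_in_eq_const
        computable_nth) auto
  then show ?thesis by (simp add: rec computable_in_iff)
qed

text \<open>The recursion counts the odd numbers below \<open>h xs\<close>.\<close>

lemma computable_half:
  assumes "computable X k h"
  shows "computable X k (\<lambda>xs. h xs div 2)"
proof -
  have rec: "rec_nat 0 (\<lambda>m r. if odd m then Suc r else r) n = n div 2" for n :: nat
    by (induction n) auto
  have "computable X k (\<lambda>xs. rec_nat 0 (\<lambda>m r. if odd m then Suc r else r) (h xs))"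
    by (intro computable_rec_nat computable_const computable_if assms computable_in_odd
        computable_nth computable_Suc) auto
  then show ?thesis by (simp only: rec)
qed

lemma computable_double:
  assumes "computable X k h"
  shows "computable X k (\<lambda>xs. 2 * h xs)"
proof -
  have rec: "rec_nat 0 (\<lambda>m r. Suc (Suc r)) n = 2 * n" for n :: nat
    by (induction n) auto
  have "computable X k (\<lambda>xs. rec_nat 0 (\<lambda>m r. Suc (Suc r)) (h xs))"
    by (intro computable_rec_nat computable_const assms computable_nth computable_Suc) auto
  then show ?thesis by (simp only: rec)
qed

text \<open>Halving the code \<open>h xs\<close> times moves the wanted bit to the last place, where
  parity reads it.\<close>

lemma computable_in_set_decode:
  assumes "computable X k g" and "computable X k h"
  shows "computable_in X k (\<lambda>xs. h xs \<in> set_decode (g xs))"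
proof -
  have rec: "rec_nat c (\<lambda>m r. r div 2) n = c div 2 ^ n" for c n :: nat
    by (induction n) (auto simp: div_mult2_eq[symmetric] mult.commute)
  have "computable X k (\<lambda>xs. rec_nat (g xs) (\<lambda>m r. r div 2) (h xs))"
    by (intro computable_rec_nat assms computable_nth computable_half) auto
  then show ?thesis by (simp only: rec set_decode_def mem_Collect_eq computable_in_odd)
qed

lemma computable_in_finite:
  "finite F \<Longrightarrow> computable X k h \<Longrightarrow> computable_in X k (\<lambda>xs. h xs \<in> F)"
  using computable_in_set_decode[OF computable_const[of _ _ "set_encode F"]] by simp

lemma computable_in_unary:
  assumes "computable_in X 1 (\<lambda>xs. P (xs ! 0))" and "computable X k g"
  shows "computable_in X k (\<lambda>xs. P (g xs))"
  using assms unfolding computable_in_iff by (rule computable_unary)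

lemma computable_in_oracle:
  assumes "computable X k h"
  shows "computable_in X k (\<lambda>xs. h xs \<in> X)"
proof (rule computable_in_unary[where P = "\<lambda>x. x \<in> X" and g = h])
  have "eval X Query xs (if xs ! 0 \<in> X then 1 else 0)" if "length xs = 1" for xs
    using that eval_Query[of X "xs ! 0"] by (cases xs) auto
  then show "computable_in X 1 (\<lambda>xs. xs ! 0 \<in> X)" unfolding computable_in_def by blast
qed (rule assms)

lemma computable_in_Bex_list:
  "(\<And>f. f \<in> set fs \<Longrightarrow> computable_in X k (P f)) \<Longrightarrow> computable_in X k (\<lambda>xs. \<exists>f\<in>set fs. P f xs)"
  by (induction fs) (auto intro: computable_in_disj computable_in_const)

section \<open>Approximating partial computations\<close>

text \<open>The value \<open>0\<close> means ``no result at stage \<open>s\<close>'', and \<open>Suc y\<close> means ``output \<open>y\<close>''.  The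
  second argument \<open>c\<close> selects the oracle, so that a single total function handles a whole
  family of oracles.\<close>

definition approximates :: "(nat \<Rightarrow> nat set) \<Rightarrow> prog \<Rightarrow> nat \<Rightarrow> (nat list \<Rightarrow> nat) \<Rightarrow> bool" where
  "approximates \<O> p k f \<longleftrightarrow> (\<forall>c xs. length xs = k \<longrightarrow>
     (\<forall>s y. f (s # c # xs) = Suc y \<longrightarrow> eval (\<O> c) p xs y) \<and>
     (\<forall>y. eval (\<O> c) p xs y \<longrightarrow> (\<forall>\<^sub>F s in sequentially. f (s # c # xs) = Suc y)))"

lemma approximatesI:
  assumes "\<And>s c xs y. length xs = k \<Longrightarrow> f (s # c # xs) = Suc y \<Longrightarrow> eval (\<O> c) p xs y"
    and "\<And>c xs y. length xs = k \<Longrightarrow> eval (\<O> c) p xs y \<Longrightarrow>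
      \<forall>\<^sub>F s in sequentially. f (s # c # xs) = Suc y"
  shows "approximates \<O> p k f"
  using assms by (simp add: approximates_def)

lemma approximates_sound:
  "approximates \<O> p k f \<Longrightarrow> f (s # c # xs) = Suc y \<Longrightarrow> length xs = k \<Longrightarrow> eval (\<O> c) p xs y"
  by (simp add: approximates_def)

lemma approximates_complete:
  "approximates \<O> p k f \<Longrightarrow> eval (\<O> c) p xs y \<Longrightarrow> length xs = k \<Longrightarrow>
    \<forall>\<^sub>F s in sequentially. f (s # c # xs) = Suc y"
  by (simp add: approximates_def)

section \<open>Approximations for the program constructors\<close>

text \<open>The same stage serves the arguments and the outer program. Completeness holds because
  finitely many eventual statements are true together at all late stages.\<close>

lemma approximation_Comp:
  assumes p: "computable X (Suc (Suc (length qs))) f" "approximates \<O> p (length qs) f"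
    and q: "\<And>q. q \<in> set qs \<Longrightarrow> computable X (Suc (Suc k)) (g q) \<and> approximates \<O> q k (g q)"
  shows "\<exists>h. computable X (Suc (Suc k)) h \<and> approximates \<O> (Comp p qs) k h"
proof (intro exI conjI)
  \<comment> \<open>Answers carry an extra successor; subtracting 1 removes it once no argument is
    unanswered.\<close>
  let ?h = "\<lambda>ys. if \<exists>q\<in>set qs. g q ys = 0 then 0
    else f (ys ! 0 # ys ! 1 # map (\<lambda>q. g q ys - 1) qs)"
  let ?gs = "(\<lambda>ys. ys ! 0) # (\<lambda>ys. ys ! 1) # map (\<lambda>q ys. g q ys - 1) qs"
  have "computable X (Suc (Suc k)) (\<lambda>ys. f (map (\<lambda>g. g ys) ?gs))"
    by (rule computable_comp) (use p q in \<open>auto intro!: computable_nth computable_pred[simplified]\<close>)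
  then have "computable X (Suc (Suc k)) (\<lambda>ys. f (ys ! 0 # ys ! 1 # map (\<lambda>q. g q ys - 1) qs))"
    by (simp add: comp_def)
  then show "computable X (Suc (Suc k)) ?h"
    by (intro computable_if computable_in_Bex_list computable_in_eq_const computable_const)
      (use q in auto)
  show "approximates \<O> (Comp p qs) k ?h"
  proof (rule approximatesI)
    fix s c y and xs :: "nat list"
    assume xs: "length xs = k" and h: "?h (s # c # xs) = Suc y"
    let ?zs = "map (\<lambda>q. g q (s # c # xs) - 1) qs"
    from h have nz: "\<forall>q\<in>set qs. g q (s # c # xs) \<noteq> 0" and f: "f (s # c # ?zs) = Suc y"
      by (auto split: if_splits)
    show "eval (\<O> c) (Comp p qs) xs y"
    proof (rule eval_Comp)
      have "eval (\<O> c) r xs (g r (s # c # xs) - 1)" if "r \<in> set qs" for r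
        using approximates_sound[OF conjunct2[OF q[OF that]] _ xs, of s c "g r (s # c # xs) - 1"] nz that by simp
      then show "list_all2 (\<lambda>q z. eval (\<O> c) q xs z) qs ?zs"
        by (auto simp: list_all2_conv_all_nth)
      show "eval (\<O> c) p ?zs y" using approximates_sound[OF p(2) f] by simp
    qed
  next
    fix c y and xs :: "nat list"
    assume xs: "length xs = k" and "eval (\<O> c) (Comp p qs) xs y"
    then obtain zs where zs: "list_all2 (\<lambda>q z. eval (\<O> c) q xs z) qs zs" and y: "eval (\<O> c) p zs y"
      by (auto elim: eval_CompE)
    from zs have len: "length zs = length qs" by (simp add: list_all2_lengthD)
    have "\<forall>\<^sub>F s in sequentially. g (qs ! i) (s # c # xs) = Suc (zs ! i)" if "i < length qs" for i
      using that zs q xs by (auto simp: list_all2_conv_all_nth intro!: approximates_complete)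
    then have "\<forall>\<^sub>F s in sequentially. \<forall>i\<in>{..<length qs}. g (qs ! i) (s # c # xs) = Suc (zs ! i)"
      by (simp add: eventually_ball_finite)
    moreover have "\<forall>\<^sub>F s in sequentially. f (s # c # zs) = Suc y"
      using approximates_complete[OF p(2) y len] .
    ultimately show "\<forall>\<^sub>F s in sequentially. ?h (s # c # xs) = Suc y"
    proof eventually_elim
      case (elim s)
      then have "map (\<lambda>q. g q (s # c # xs) - 1) qs = zs"
        using len by (auto intro!: nth_equalityI)
      moreover from elim have "\<forall>q\<in>set qs. g q (s # c # xs) \<noteq> 0" by (auto simp: in_set_conv_nth)
      ultimately show ?case using elim by auto
    qed
  qed
qed

lemma approximation_Prec:
  assumes f: "computable X (Suc (Suc k)) f" "approximates \<O> p k f"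
    and g: "computable X (Suc (Suc (Suc (Suc k)))) g" "approximates \<O> q (Suc (Suc k)) g"
  shows "\<exists>h. computable X (Suc (Suc (Suc k))) h \<and> approximates \<O> (Prec p q) (Suc k) h"
proof (intro exI conjI)
  \<comment> \<open>The recursion runs at a fixed stage, and a missing answer 0 is passed on to all
    later steps. \<open>?h\<close> is the same function reading its parameters from the
    list.\<close>
  let ?r = "\<lambda>s c xs. rec_nat (f (s # c # xs)) (\<lambda>m r. if r = 0 then 0 else g (s # c # m # (r - 1) # xs))"
  let ?G = "\<lambda>m r ys. if r = 0 then 0 else g (ys ! 0 # ys ! 1 # m # (r - 1) # drop 3 ys)"
  let ?h = "\<lambda>ys. rec_nat (f (ys ! 0 # ys ! 1 # drop 3 ys)) (\<lambda>m r. ?G m r ys) (ys ! 2)"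
  \<comment> \<open>The list holds counter, previous value, stage, oracle code and recursion length
    before the parameters, hence \<open>drop 5\<close>.\<close>
  have "computable X (5 + k) (\<lambda>zs. if zs ! 1 = 0 then 0
      else g (zs ! 2 # zs ! 3 # zs ! 0 # (zs ! 1 - 1) # drop 5 zs))"
    using computable_comp_drop[of X "[\<lambda>zs. zs ! 2, \<lambda>zs. zs ! 3, \<lambda>zs. zs ! 0, \<lambda>zs. zs ! 1 - 1]" k g 5] g(1)
    by (intro computable_if computable_const computable_in_eq_const computable_nth)
      (simp_all add: computable_nth computable_pred[simplified])
  then have "computable X (5 + k) (\<lambda>zs. ?G (zs ! 0) (zs ! 1) (drop 2 zs))"
    by (rule computable_cong[THEN iffD1, rotated]) (simp add: numeral_eq_Suc)
  moreover have "computable X (3 + k) (\<lambda>ys. f (ys ! 0 # ys ! 1 # drop 3 ys))"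
    using computable_comp_drop[of X "[\<lambda>zs. zs ! 0, \<lambda>zs. zs ! 1]" k f 3] f(1)
    by (simp add: computable_nth)
  ultimately show "computable X (Suc (Suc (Suc k))) ?h"
    by (intro computable_rec_nat computable_nth) (simp_all add: numeral_eq_Suc)
  have h: "?h (s # c # n # xs) = ?r s c xs n" for s c n xs
    by (simp add: numeral_2_eq_2 numeral_3_eq_3 cong: if_cong)
  show "approximates \<O> (Prec p q) (Suc k) ?h"
  proof (rule approximatesI)
    fix s c y and xs' :: "nat list"
    assume "length xs' = Suc k" and hy: "?h (s # c # xs') = Suc y"
    then obtain n xs where xs': "xs' = n # xs" and xs: "length xs = k"
      by (auto simp: length_Suc_conv)
    have "?r s c xs n = Suc y \<Longrightarrow> eval (\<O> c) (Prec p q) (n # xs) y" for y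
    proof (induction n arbitrary: y)
      case 0
      then show ?case using approximates_sound[OF f(2) _ xs] by (simp add: eval_Prec_0)
    next
      case (Suc n)
      then obtain r where r: "?r s c xs n = Suc r" by (cases "?r s c xs n") auto
      with Suc.prems have "g (s # c # n # r # xs) = Suc y" by simp
      from approximates_sound[OF g(2) this] xs have "eval (\<O> c) q (n # r # xs) y" by simp
      with Suc.IH[OF r] show ?case by (rule eval_Prec_Suc)
    qed
    with hy show "eval (\<O> c) (Prec p q) xs' y" unfolding xs' h by blast
  next
    fix c y and xs' :: "nat list"
    assume "length xs' = Suc k" and e: "eval (\<O> c) (Prec p q) xs' y"
    then obtain n xs where xs': "xs' = n # xs" and xs: "length xs = k"
      by (auto simp: length_Suc_conv)
    have "eval (\<O> c) (Prec p q) (n # xs) y \<Longrightarrow> \<forall>\<^sub>F s in sequentially. ?r s c xs n = Suc y" for y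
    proof (induction n arbitrary: y)
      case 0
      then have "eval (\<O> c) p xs y" by (rule eval_Prec_0E)
      then show ?case using approximates_complete[OF f(2) _ xs] by simp
    next
      case (Suc n)
      from Suc.prems obtain r where r: "eval (\<O> c) (Prec p q) (n # xs) r"
        and y: "eval (\<O> c) q (n # r # xs) y"
        by (rule eval_Prec_SucE)
      from approximates_complete[OF g(2) y] xs Suc.IH[OF r]
      have "\<forall>\<^sub>F s in sequentially. g (s # c # n # r # xs) = Suc y"
        and "\<forall>\<^sub>F s in sequentially. ?r s c xs n = Suc r" by simp_all
      then show ?case by eventually_elim simp
    qed
    with e show "\<forall>\<^sub>F s in sequentially. ?h (s # c # xs') = Suc y" unfolding xs' h by blast
  qed
qed

text \<open>The result \<open>0\<close> means that \<open>F m \<ge> 2\<close> for all inspected \<open>m\<close>, \<open>1\<close> that the search met the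
  value \<open>0\<close> first, and \<open>m + 2\<close> that it met the value \<open>1\<close> first, at position \<open>m\<close>.\<close>

definition bounded_search :: "(nat \<Rightarrow> nat) \<Rightarrow> nat \<Rightarrow> nat" where
  "bounded_search F = rec_nat 0 (\<lambda>m r. if r = 0
     then if F m = 1 then Suc (Suc m) else if F m = 0 then 1 else 0 else r)"

lemma bounded_search_simps:
  "bounded_search F 0 = 0"
  "bounded_search F (Suc n) = (if bounded_search F n = 0
     then if F n = 1 then Suc (Suc n) else if F n = 0 then 1 else 0 else bounded_search F n)"
  by (simp_all add: bounded_search_def)

lemma bounded_search_eq_0: "bounded_search F n = 0 \<longleftrightarrow> (\<forall>m<n. 2 \<le> F m)"
  by (induction n) (auto simp: bounded_search_simps less_Suc_eq)

text \<open>A nonzero result is never changed afterwards, so it is fixed by the first position where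
  \<open>F\<close> is below 2.\<close>

lemma bounded_search_eq_Suc_Suc:
  "bounded_search F n = Suc (Suc m) \<longleftrightarrow> m < n \<and> F m = 1 \<and> (\<forall>j<m. 2 \<le> F j)"
proof (induction n)
  case 0
  show ?case by (simp add: bounded_search_simps)
next
  case (Suc n)
  show ?case
  proof (cases "bounded_search F n = 0")
    case True
    then have "\<forall>m<n. 2 \<le> F m" by (simp add: bounded_search_eq_0)
    then show ?thesis using True
      by (auto simp: bounded_search_simps less_Suc_eq)
  next
    case False
    then have "\<not> (\<forall>m<n. 2 \<le> F m)" by (simp add: bounded_search_eq_0)
    then show ?thesis using False Suc
      by (auto simp: bounded_search_simps less_Suc_eq)
  qed
qed

text \<open>Stage \<open>s\<close> inspects the positions below \<open>s\<close>. An unanswered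
  position ends the search, because \<open>Mu\<close> requires a positive value at every smaller
  position.\<close>

lemma approximation_Mu:
  assumes f: "computable X (Suc (Suc (Suc k))) f" "approximates \<O> p (Suc k) f"
  shows "\<exists>h. computable X (Suc (Suc k)) h \<and> approximates \<O> (Mu p) k h"
proof (intro exI conjI)
  let ?F = "\<lambda>ys m. f (ys ! 0 # ys ! 1 # m # drop 2 ys)"
  \<comment> \<open>Subtracting 1 merges the two failures 0 and 1, and turns \<open>m + 2\<close>
    into \<open>Suc m\<close>, which stands for output \<open>m\<close>.\<close>
  let ?h = "\<lambda>ys. bounded_search (?F ys) (ys ! 0) - 1"
  have "computable X (4 + k) (\<lambda>zs. f (zs ! 2 # zs ! 3 # zs ! 0 # drop 4 zs))"
    using computable_comp_drop[of X "[\<lambda>zs. zs ! 2, \<lambda>zs. zs ! 3, \<lambda>zs. zs ! 0]" k f 4] f(1)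
    by (simp add: computable_nth)
  then have F: "computable X (4 + k) (\<lambda>zs. ?F (drop 2 zs) (zs ! 0))"
    by (rule computable_cong[THEN iffD1, rotated]) (simp add: numeral_eq_Suc)
  show "computable X (Suc (Suc k)) ?h"
    unfolding bounded_search_def
    by (rule computable_pred, rule computable_rec_nat, rule computable_const)
      (use F in \<open>intro computable_if computable_const computable_Suc computable_in_eq_const computable_nth;
         simp add: numeral_eq_Suc\<close>)+
  have h: "?h (s # c # xs) = Suc y \<longleftrightarrow> y < s \<and> f (s # c # y # xs) = 1 \<and> (\<forall>j<y. 2 \<le> f (s # c # j # xs))" for s c y xs
  proof -
    have "?h (s # c # xs) = Suc y \<longleftrightarrow> bounded_search (?F (s # c # xs)) s = Suc (Suc y)"
      by auto
    then show ?thesis unfolding bounded_search_eq_Suc_Suc by simp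
  qed
  show "approximates \<O> (Mu p) k ?h"
  proof (rule approximatesI)
    fix s c y and xs :: "nat list"
    assume xs: "length xs = k" and "?h (s # c # xs) = Suc y"
    then have *: "f (s # c # y # xs) = Suc 0" "\<And>j. j < y \<Longrightarrow> 2 \<le> f (s # c # j # xs)"
      unfolding h by auto
    show "eval (\<O> c) (Mu p) xs y"
    proof (rule eval_Mu)
      show "eval (\<O> c) p (y # xs) 0" using approximates_sound[OF f(2) *(1)] xs by simp
      fix m assume "m < y"
      from *(2)[OF this] have "f (s # c # m # xs) = Suc (Suc (f (s # c # m # xs) - 2))" by simp
      from approximates_sound[OF f(2) this] xs
      show "\<exists>k. eval (\<O> c) p (m # xs) (Suc k)" by auto
    qed
  next
    fix c y and xs :: "nat list"
    assume xs: "length xs = k" and e: "eval (\<O> c) (Mu p) xs y"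
    have "\<forall>\<^sub>F s in sequentially. 2 \<le> f (s # c # j # xs)" if "j < y" for j
    proof -
      from e that obtain l where "eval (\<O> c) p (j # xs) (Suc l)" by (blast elim: eval_MuE)
      from approximates_complete[OF f(2) this] xs
      have "\<forall>\<^sub>F s in sequentially. f (s # c # j # xs) = Suc (Suc l)" by simp
      then show ?thesis by eventually_elim simp
    qed
    then have "\<forall>\<^sub>F s in sequentially. \<forall>j\<in>{..<y}. 2 \<le> f (s # c # j # xs)"
      by (simp add: eventually_ball_finite)
    moreover from e have "eval (\<O> c) p (y # xs) 0" by (blast elim: eval_MuE)
    from approximates_complete[OF f(2) this] xs
    have "\<forall>\<^sub>F s in sequentially. f (s # c # y # xs) = Suc 0" by simp
    ultimately show "\<forall>\<^sub>F s in sequentially. ?h (s # c # xs) = Suc y"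
      \<comment> \<open>The stage must exceed \<open>y\<close> for position \<open>y\<close> to be
        inspected.\<close>
      using eventually_gt_at_top[of y] by eventually_elim (simp only: h, simp)
  qed
qed

text \<open>The induction covers all arities at once, as subprograms act on lists of other lengths.
  On lengths where a program is never defined, the constant 0 approximates it. The oracle family
  enters only at \<open>Query\<close>.\<close>

lemma approximation:
  assumes \<O>: "computable_in X 2 (\<lambda>xs. xs ! 1 \<in> \<O> (xs ! 0))"
  shows "\<exists>f. computable X (Suc (Suc k)) f \<and> approximates \<O> p k f"
proof (induction p arbitrary: k)
  case Zero
  show ?case
    \<comment> \<open>The value 1 stands for output 0.\<close>
    by (rule exI[of _ "\<lambda>_. 1"])
      (auto simp: approximates_def intro: computable_const[of _ _ "Suc 0"] eval_Zero elim: eval_ZeroE)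
next
  case Succ
  show ?case
  proof (cases "k = 1")
    case True
    then show ?thesis
      by (intro exI[of _ "\<lambda>ys. Suc (Suc (ys ! 2))"] conjI computable_Suc computable_nth approximatesI)
        (auto simp: length_Suc_conv intro: eval_Succ elim: eval_SuccE)
  next
    case False
    then show ?thesis
      by (intro exI[of _ "\<lambda>_. 0"] conjI computable_const approximatesI) (auto elim: eval_SuccE)
  qed
next
  case (Proj i)
  show ?case
  proof (cases "i < k")
    case True
    then show ?thesis
      by (intro exI[of _ "\<lambda>ys. Suc (ys ! Suc (Suc i))"] conjI computable_Suc computable_nth approximatesI)
        (auto intro: eval_Proj elim: eval_ProjE)
  next
    case False
    then show ?thesis
      by (intro exI[of _ "\<lambda>_. 0"] conjI computable_const approximatesI) (auto elim: eval_ProjE)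
  qed
next
  case Query
  show ?case
  proof (cases "k = 1")
    case True
    let ?f = "\<lambda>ys. if ys ! 2 \<in> \<O> (ys ! 1) then Suc 1 else Suc 0"
    have "computable X 3 (\<lambda>ys. if ys ! 2 \<in> \<O> (ys ! 1) then 1 else 0)"
      using computable_comp[of X "[\<lambda>ys. ys ! 1, \<lambda>ys. ys ! 2]" "\<lambda>xs. if xs ! 1 \<in> \<O> (xs ! 0) then 1 else 0" 3] \<O>
      by (simp add: computable_in_iff numeral_2_eq_2 computable_nth)
    then have "computable X 3 ?f"
      by (intro computable_if computable_const) (simp add: computable_in_iff)
    moreover have "approximates \<O> Query 1 ?f"
    proof (rule approximatesI)
      fix s c y and xs :: "nat list"
      assume "length xs = 1" "?f (s # c # xs) = Suc y"
      then show "eval (\<O> c) Query xs y"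
        using eval_Query[of "\<O> c" "xs ! 0"] by (cases xs) (auto split: if_splits)
    qed (auto elim: eval_QueryE)
    ultimately show ?thesis using True by (auto simp: numeral_3_eq_3)
  next
    case False
    then show ?thesis
      by (intro exI[of _ "\<lambda>_. 0"] conjI computable_const approximatesI) (auto elim: eval_QueryE)
  qed
next
  case (Comp p qs)
  from Comp.IH(1) obtain f where "computable X (Suc (Suc (length qs))) f" "approximates \<O> p (length qs) f"
    by blast
  moreover from Comp.IH(2) have "\<forall>q\<in>set qs. \<exists>f. computable X (Suc (Suc k)) f \<and> approximates \<O> q k f"
    by blast
  then obtain g where "\<And>q. q \<in> set qs \<Longrightarrow> computable X (Suc (Suc k)) (g q) \<and> approximates \<O> q k (g q)"
    by metis
  ultimately show ?case by (rule approximation_Comp)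
next
  case (Prec p q)
  show ?case
  proof (cases k)
    case 0
    \<comment> \<open>An empty list offers no recursion argument.\<close>
    have "eval Y (Prec p q) xs y \<Longrightarrow> xs \<noteq> []" for Y xs y by (cases xs) (auto elim: eval.cases)
    with 0 show ?thesis
      by (intro exI[of _ "\<lambda>_. 0"] conjI computable_const approximatesI) auto
  next
    case (Suc l)
    with Prec.IH(1)[of l] Prec.IH(2)[of "Suc (Suc l)"] approximation_Prec show ?thesis by blast
  qed
next
  case (Mu p)
  with approximation_Mu show ?case by blast
qed

text \<open>A value that shows up at one stage is correct, so no convergence stage is needed and the
  three existential quantifiers can share one bound.\<close>

lemma Sigma1_oracle_family:
  assumes "computable_in X 2 (\<lambda>xs. xs ! 1 \<in> \<O> (xs ! 0))"
  shows "Sigma1 X {n. \<exists>c a. eval (\<O> c) p [n, a] 1}"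
proof -
  from approximation[OF assms] obtain f where f: "computable X 4 f" "approximates \<O> p 2 f"
    by (metis Suc_numeral semiring_norm(2,5,8))
  \<comment> \<open>The value 2 stands for output 1; \<open>ys ! 0\<close> is the enumerated number
    and \<open>ys ! 1\<close> the stage.\<close>
  let ?P = "\<lambda>c a ys. f [ys ! 1, c, ys ! 0, a] = 2"
  have "computable X 4 (\<lambda>zs. f [zs ! 3, zs ! 1, zs ! 2, zs ! 0])"
    using computable_comp[of X "[\<lambda>zs. zs ! 3, \<lambda>zs. zs ! 1, \<lambda>zs. zs ! 2, \<lambda>zs. zs ! 0]" f 4] f(1)
    by (simp add: computable_nth eval_nat_numeral)
  then have "computable_in X 4 (\<lambda>zs. f [zs ! 3, zs ! 1, zs ! 2, zs ! 0] = 2)"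
    by (rule computable_in_eq_const)
  \<comment> \<open>Each bounded quantifier puts its variable in front, so the list is
    \<open>a\<close>, \<open>c\<close>, the enumerated number, the stage.\<close>
  then have "computable_in X 4 (\<lambda>zs. ?P (drop 1 zs ! 0) (zs ! 0) (drop 1 (drop 1 zs)))"
    by (rule computable_in_cong[THEN iffD1, rotated]) (simp add: numeral_2_eq_2 numeral_3_eq_3)
  then have "computable_in X (Suc (Suc 2)) (\<lambda>zs. ?P (drop 1 zs ! 0) (zs ! 0) (drop 1 (drop 1 zs)))"
    by simp
  then have "computable_in X (Suc 2) (\<lambda>zs. \<exists>a<drop 1 zs ! 1. ?P (zs ! 0) a (drop 1 zs))"
    by (rule computable_in_Bex_less)
      (use computable_drop[OF computable_nth[of 1 2 X], of 1] in \<open>simp add: numeral_3_eq_3\<close>)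
  then have R: "computable_in X 2 (\<lambda>ys. \<exists>c<ys ! 1. \<exists>a<ys ! 1. ?P c a ys)"
    by (rule computable_in_Bex_less) (rule computable_nth, simp)
  have "(\<exists>c a. eval (\<O> c) p [n, a] 1) \<longleftrightarrow> (\<exists>s. \<exists>c<s. \<exists>a<s. f [s, c, n, a] = 2)" for n
  proof
    assume "\<exists>c a. eval (\<O> c) p [n, a] 1"
    then obtain c a where "eval (\<O> c) p [n, a] 1" by blast
    from approximates_complete[OF f(2) this]
    have "\<forall>\<^sub>F s in sequentially. f [s, c, n, a] = 2" by (simp add: numeral_2_eq_2)
    then have "\<forall>\<^sub>F s in sequentially. c < s \<and> a < s \<and> f [s, c, n, a] = 2"
      using eventually_gt_at_top[of c] eventually_gt_at_top[of a] by eventually_elim simp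
    then show "\<exists>s. \<exists>c<s. \<exists>a<s. f [s, c, n, a] = 2" by (auto simp: eventually_sequentially)
  next
    assume "\<exists>s. \<exists>c<s. \<exists>a<s. f [s, c, n, a] = 2"
    then obtain s c a where "f [s, c, n, a] = Suc 1" by (metis Suc_1)
    from approximates_sound[OF f(2) this] have "eval (\<O> c) p [n, a] 1" by simp
    then show "\<exists>c a. eval (\<O> c) p [n, a] 1" by blast
  qed
  with R show ?thesis
    unfolding Sigma1_def by (intro exI[of _ "\<lambda>ys. \<exists>c<ys ! 1. \<exists>a<ys ! 1. ?P c a ys"] conjI) simp_all
qed

section \<open>Dependence on the oracle\<close>

text \<open>The use principle: a converging computation consults its oracle finitely often. The
  eventual form spares taking maxima of the bounds for the subcomputations.\<close>

lemma eval_use: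
  "eval X p xs y \<Longrightarrow>
    \<forall>\<^sub>F u in sequentially. \<forall>Y. Y \<inter> {..<u} = X \<inter> {..<u} \<longrightarrow> eval Y p xs y"
proof (induction rule: eval.induct)
  case (eval_Query x)
  from eventually_gt_at_top[of x] show ?case
  proof eventually_elim
    case (elim u)
    have "eval Y Query [x] (if x \<in> X then 1 else 0)" if "Y \<inter> {..<u} = X \<inter> {..<u}" for Y
    proof -
      from that elim have "x \<in> X \<longleftrightarrow> x \<in> Y" by blast
      with eval.eval_Query[of Y x] show ?thesis by simp
    qed
    then show ?case by blast
  qed
next
  case (eval_Comp xs qs zs p y)
  from eval_Comp.IH(1) have len: "length qs = length zs" and
    "\<forall>i<length qs. \<forall>\<^sub>F u in sequentially.
      \<forall>Y. Y \<inter> {..<u} = X \<inter> {..<u} \<longrightarrow> eval Y (qs ! i) xs (zs ! i)"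
    by (simp_all add: list_all2_conv_all_nth)
  then have "\<forall>\<^sub>F u in sequentially. \<forall>i\<in>{..<length qs}.
      \<forall>Y. Y \<inter> {..<u} = X \<inter> {..<u} \<longrightarrow> eval Y (qs ! i) xs (zs ! i)"
    by (intro eventually_ball_finite) simp_all
  with eval_Comp.IH(2) show ?case
  proof eventually_elim
    case (elim u)
    show ?case
    proof (intro allI impI)
      fix Y assume Y: "Y \<inter> {..<u} = X \<inter> {..<u}"
      with elim(2) len have "list_all2 (\<lambda>q z. eval Y q xs z) qs zs"
        by (simp add: list_all2_conv_all_nth)
      moreover from elim(1) Y have "eval Y p zs y" by blast
      ultimately show "eval Y (Comp p qs) xs y" by (rule eval.eval_Comp)
    qed
  qed
next
  case (eval_Prec_Suc p q n xs r y)
  from eval_Prec_Suc.IH show ?case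
    by eventually_elim (blast intro: eval.eval_Prec_Suc)
next
  case (eval_Mu p n xs)
  from eval_Mu.IH(2) have "\<forall>m\<in>{..<n}. \<forall>\<^sub>F u in sequentially.
      \<forall>Y. Y \<inter> {..<u} = X \<inter> {..<u} \<longrightarrow> (\<exists>k. eval Y p (m # xs) (Suc k))"
    by (blast intro: eventually_mono)
  then have "\<forall>\<^sub>F u in sequentially. \<forall>m\<in>{..<n}.
      \<forall>Y. Y \<inter> {..<u} = X \<inter> {..<u} \<longrightarrow> (\<exists>k. eval Y p (m # xs) (Suc k))"
    by (intro eventually_ball_finite) simp_all
  with eval_Mu.IH(1) show ?case
  proof eventually_elim
    case (elim u)
    show ?case
    proof (intro allI impI eval.eval_Mu)
      fix Y assume Y: "Y \<inter> {..<u} = X \<inter> {..<u}"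
      with elim(1) show "eval Y p (n # xs) 0" by blast
      fix m assume "m < n"
      with elim(2) Y show "\<exists>k. eval Y p (m # xs) (Suc k)" by blast
    qed
  qed
next
  case (eval_Prec_0 p xs y q)
  from eval_Prec_0.IH show ?case by eventually_elim (simp add: eval.eval_Prec_0)
qed (simp_all add: eval.intros)

lemma mem_join: "x \<in> Z \<oplus> C \<longleftrightarrow> (if even x then x div 2 \<in> Z else x div 2 \<in> C)"
  unfolding join_def
  by (cases "even x")
    (auto elim!: evenE oddE simp: Suc_double_not_eq_double double_not_eq_Suc_double)

lemma join_cong:
  assumes "Y \<inter> {..<u} = X \<inter> {..<u}"
  shows "(Z \<oplus> Y) \<inter> {..<u} = (Z \<oplus> X) \<inter> {..<u}"
proof -
  have "x \<in> Z \<oplus> Y \<longleftrightarrow> x \<in> Z \<oplus> X" if "x < u" for x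
  proof -
    from that have "x div 2 < u" by simp
    with assms have "x div 2 \<in> Y \<longleftrightarrow> x div 2 \<in> X" by blast
    then show ?thesis by (simp add: mem_join)
  qed
  then show ?thesis by blast
qed

text \<open>Measures the use on the second component of the join: a query \<open>x\<close> asks
  about \<open>x div 2\<close>, which is at most \<open>x\<close>.\<close>

lemma eval_join_use:
  assumes "eval (Z \<oplus> X) p xs y"
  obtains u where "\<And>Y. Y \<inter> {..<u} = X \<inter> {..<u} \<Longrightarrow> eval (Z \<oplus> Y) p xs y"
proof -
  from eval_use[OF assms] obtain u where
    u: "\<forall>n\<ge>u. \<forall>W. W \<inter> {..<n} = (Z \<oplus> X) \<inter> {..<n} \<longrightarrow> eval W p xs y"
    unfolding eventually_sequentially by (rule exE)
  show thesis
  proof (rule that)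
    fix Y assume "Y \<inter> {..<u} = X \<inter> {..<u}"
    from u[rule_format, OF order_refl join_cong[OF this]] show "eval (Z \<oplus> Y) p xs y" .
  qed
qed

section \<open>Change of oracle, and complements\<close>

primrec replace_query :: "prog \<Rightarrow> prog \<Rightarrow> prog" where
  "replace_query r Zero = Zero"
| "replace_query r Succ = Succ"
| "replace_query r (Proj i) = Proj i"
| "replace_query r Query = r"
| "replace_query r (Comp p qs) = Comp (replace_query r p) (map (replace_query r) qs)"
| "replace_query r (Prec p q) = Prec (replace_query r p) (replace_query r q)"
| "replace_query r (Mu p) = Mu (replace_query r p)"

text \<open>One direction suffices for decidable relations: their programs converge on every list of
  the right length, and the outputs carry over.\<close>

lemma eval_replace_query:
  assumes "\<And>x. eval Y r [x] (if x \<in> X then 1 else 0)"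
  shows "eval X p xs y \<Longrightarrow> eval Y (replace_query r p) xs y"
proof (induction rule: eval.induct)
  case (eval_Query x)
  show ?case using assms by simp
next
  case (eval_Comp xs qs zs p y)
  then have "list_all2 (\<lambda>q z. eval Y q xs z) (map (replace_query r) qs) zs"
    by (simp add: list_all2_conv_all_nth)
  with eval_Comp.IH(2) show ?case by (auto intro: eval.eval_Comp)
next
  case (eval_Mu p n xs)
  then show ?case by (auto intro!: eval.eval_Mu)
qed (auto intro: eval.intros)

lemma computable_in_trans:
  assumes "computable_in Y 1 (\<lambda>xs. xs ! 0 \<in> X)" and "computable_in X k R"
  shows "computable_in Y k R"
proof -
  from assms(1) obtain r where "\<And>xs. length xs = 1 \<Longrightarrow> eval Y r xs (if xs ! 0 \<in> X then 1 else 0)"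
    by (auto simp: computable_in_def)
  from this[of "[_]"] have "eval Y r [x] (if x \<in> X then 1 else 0)" for x by simp
  with eval_replace_query[of Y r X] assms(2) show ?thesis
    unfolding computable_in_def by meson
qed

lemma double_mem_join: "2 * x \<in> Z \<oplus> C \<longleftrightarrow> x \<in> Z"
  by (simp add: mem_join)

lemma computable_in_join:
  assumes "computable_in Z k R"
  shows "computable_in (Z \<oplus> C) k R"
proof (rule computable_in_trans[OF _ assms])
  have "computable_in (Z \<oplus> C) 1 (\<lambda>xs. 2 * xs ! 0 \<in> Z \<oplus> C)"
    by (intro computable_in_oracle computable_double computable_nth) simp
  then show "computable_in (Z \<oplus> C) 1 (\<lambda>xs. xs ! 0 \<in> Z)"
    unfolding double_mem_join .
qed

text \<open>Only the failure to be \<open>Sigma1\<close> or \<open>Pi1\<close> can be lost when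
  passing to a join.\<close>

lemma Delta2_join: "Delta2 Z B \<Longrightarrow> Delta2 (Z \<oplus> C) B"
  unfolding Delta2_def Sigma2_def Pi2_def by (blast intro: computable_in_join)

text \<open>Complements turn the avoidance of \<open>Pi1\<close> definitions into that of
  \<open>Sigma1\<close> definitions, so the forcing handles a single kind of requirement.\<close>

lemma Pi1_uminus: "Pi1 X B \<Longrightarrow> Sigma1 X (- B)"
  unfolding Pi1_def Sigma1_def
proof (elim exE conjE)
  fix R assume "computable_in X 2 R" "B = {n. \<forall>a. R [n, a]}"
  then show "\<exists>R. computable_in X 2 R \<and> - B = {n. \<exists>a. R [n, a]}"
    by (intro exI[of _ "\<lambda>xs. \<not> R xs"] conjI computable_in_not) auto
qed

lemma Sigma1_uminus: "Sigma1 X (- B) \<Longrightarrow> Pi1 X B"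
  unfolding Pi1_def Sigma1_def
proof (elim exE conjE)
  fix R assume R: "computable_in X 2 R" "- B = {n. \<exists>a. R [n, a]}"
  then have "B = {n. \<forall>a. \<not> R [n, a]}" by auto
  with R(1) show "\<exists>R. computable_in X 2 R \<and> B = {n. \<forall>a. R [n, a]}"
    by (intro exI[of _ "\<lambda>xs. \<not> R xs"] conjI computable_in_not)
qed

section \<open>Countability of programs and of the sets they define\<close>

instance prog :: countable
  by countable_datatype

text \<open>Acceptance by output 1 makes sense for every program, total or not, so programs can
  index the definable sets.\<close>

lemma computable_in_eval:
  assumes "computable_in X k R"
  obtains p where "\<And>xs. length xs = k \<Longrightarrow> R xs \<longleftrightarrow> eval X p xs 1"
proof -
  from assms obtain p where p: "\<And>xs. length xs = k \<Longrightarrow> eval X p xs (if R xs then 1 else 0)"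
    by (auto simp: computable_in_def)
  have "R xs \<longleftrightarrow> eval X p xs 1" if "length xs = k" for xs
    using p[OF that] eval_deterministic[of X p xs 1 0] by (cases "R xs") auto
  then show thesis by (rule that)
qed

lemma countable_Sigma2: "countable {B. Sigma2 X B}"
proof (rule countable_subset)
  \<comment> \<open>Partial programs may contribute further sets; an inclusion is enough.\<close>
  show "{B. Sigma2 X B} \<subseteq> range (\<lambda>p. {n. \<exists>a. \<forall>b. eval X p [n, a, b] 1})"
  proof (clarify, unfold Sigma2_def, elim exE conjE)
    fix B R assume "computable_in X 3 R" and B: "B = {n. \<exists>a. \<forall>b. R [n, a, b]}"
    then obtain p where "\<And>xs. length xs = 3 \<Longrightarrow> R xs \<longleftrightarrow> eval X p xs 1"
      using computable_in_eval[of X 3 R] by blast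
    with B have "B = {n. \<exists>a. \<forall>b. eval X p [n, a, b] 1}" by simp
    then show "B \<in> range (\<lambda>p. {n. \<exists>a. \<forall>b. eval X p [n, a, b] 1})" by blast
  qed
qed simp

section \<open>Mathias forcing with computable reservoirs\<close>

text \<open>The requirements are met one after another along a descending chain of conditions.
  Density provides a condition that places every compatible set in \<open>Q\<close>, and the union
  of the stems is compatible with the whole chain.\<close>

lemma generic_exists:
  fixes cond :: "'a set \<Rightarrow> 'a set \<Rightarrow> bool"
  assumes init: "cond F0 X0"
    and "countable \<Q>"
    and dense: "\<And>Q F X. Q \<in> \<Q> \<Longrightarrow> cond F X \<Longrightarrow> \<exists>F' X'. cond F' X' \<and>
      F \<subseteq> F' \<and> F' \<subseteq> F \<union> X \<and> X' \<subseteq> X \<and> (\<forall>C. F' \<subseteq> C \<and> C \<subseteq> F' \<union> X' \<longrightarrow> C \<in> Q)"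
  shows "\<exists>C. \<forall>Q\<in>\<Q>. C \<in> Q"
proof (cases "\<Q> = {}")
  case True
  then show ?thesis by simp
next
  case False
  define q where "q = from_nat_into \<Q>"
  have range_q: "range q = \<Q>"
    using False \<open>countable \<Q>\<close> by (simp add: q_def)
  define step where "step n c c' \<longleftrightarrow> fst c \<subseteq> fst c' \<and> fst c' \<subseteq> fst c \<union> snd c \<and> snd c' \<subseteq> snd c \<and>
      (\<forall>C. fst c' \<subseteq> C \<and> C \<subseteq> fst c' \<union> snd c' \<longrightarrow> C \<in> q n)" for n c c'
  have "\<exists>c. \<forall>n. case_prod cond (c n) \<and> step n (c n) (c (Suc n))"
  proof (rule dependent_nat_choice)
    show "\<exists>c. case_prod cond c" using init by auto
    fix c n assume "case_prod cond c"
    then show "\<exists>c'. case_prod cond c' \<and> step n c c'"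
      using dense[of "q n" "fst c" "snd c"] range_q by (auto simp: step_def split: prod.splits)
  qed
  then obtain c where c: "step n (c n) (c (Suc n))" for n by blast
  define C where "C = (\<Union>n. fst (c n))"
  have below: "fst (c m) \<subseteq> fst (c n) \<union> snd (c n) \<and> snd (c m) \<subseteq> snd (c n)" if "n \<le> m" for m n
    using that
  proof (induction m rule: dec_induct)
    case (step m)
    with c[of m] show ?case unfolding step_def by blast
  qed simp
  have mono: "fst (c m) \<subseteq> fst (c n)" if "m \<le> n" for m n
    by (rule lift_Suc_mono_le[OF _ that]) (use c in \<open>simp add: step_def\<close>)
  \<comment> \<open>Earlier stems lie in the stem of stage \<open>n\<close> by \<open>mono\<close>,
    later ones in its stem and reservoir by \<open>below\<close>.\<close>
  have "C \<subseteq> fst (c n) \<union> snd (c n)" for n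
    unfolding C_def using below mono by (meson UN_least le_sup_iff linear order_trans sup_ge1)
  moreover have "fst (c n) \<subseteq> C" for n by (auto simp: C_def)
  ultimately have "C \<in> q n" for n using c[of n] by (simp add: step_def)
  with range_q show ?thesis by blast
qed

text \<open>Computability of the reservoir makes the oracles
  \<open>Z \<oplus> (F \<union> E)\<close> uniformly computable in \<open>Z\<close> from codes,
  which is why the numbers they enumerate form a \<open>Sigma1\<close> set. In both cases the use
  principle links finite extensions with arbitrary compatible sets.\<close>

lemma extension_avoiding_Sigma1:
  assumes B: "\<not> Sigma1 Z B" and F: "finite F" and X: "infinite X"
    and comp: "computable_in Z 1 (\<lambda>xs. xs ! 0 \<in> X)"
  shows "\<exists>F' X'. (finite F' \<and> infinite X' \<and> computable_in Z 1 (\<lambda>xs. xs ! 0 \<in> X')) \<and>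
    F \<subseteq> F' \<and> F' \<subseteq> F \<union> X \<and> X' \<subseteq> X \<and>
    (\<forall>C. F' \<subseteq> C \<and> C \<subseteq> F' \<union> X' \<longrightarrow> B \<noteq> {n. \<exists>a. eval (Z \<oplus> C) p [n, a] 1})"
proof (cases "\<exists>n E a. n \<notin> B \<and> finite E \<and> E \<subseteq> X \<and> eval (Z \<oplus> (F \<union> E)) p [n, a] 1")
  case True
  then obtain n E a where n: "n \<notin> B" and E: "finite E" "E \<subseteq> X"
    and e: "eval (Z \<oplus> (F \<union> E)) p [n, a] 1" by blast
  from e obtain u where
    u: "\<And>Y. Y \<inter> {..<u} = (F \<union> E) \<inter> {..<u} \<Longrightarrow> eval (Z \<oplus> Y) p [n, a] 1"
    by (rule eval_join_use) blast
  \<comment> \<open>Removing the numbers below the use from the reservoir freezes the part of the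
    oracle that the computation consults.\<close>
  have "eval (Z \<oplus> C) p [n, a] 1" if "F \<union> E \<subseteq> C" "C \<subseteq> (F \<union> E) \<union> (X - {..<u})" for C
    by (rule u) (use that in blast)
  with n have avoid: "\<forall>C. F \<union> E \<subseteq> C \<and> C \<subseteq> (F \<union> E) \<union> (X - {..<u}) \<longrightarrow>
      B \<noteq> {n. \<exists>a. eval (Z \<oplus> C) p [n, a] 1}"
    by blast
  have "computable_in Z 1 (\<lambda>xs. xs ! 0 \<in> X - {..<u})"
    unfolding Diff_iff
    by (intro computable_in_conj comp computable_in_not computable_in_finite computable_nth) simp_all
  moreover have "infinite (X - {..<u})" using X by simp
  ultimately show ?thesis using F E
    by (intro exI[of _ "F \<union> E"] exI[of _ "X - {..<u}"] conjI avoid) blast+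
next
  case False
  \<comment> \<open>Intersecting with \<open>X\<close> makes every number \<open>c\<close> the code
    of an admissible extension, and every finite subset of \<open>X\<close> still has a
    code.\<close>
  define \<O> where "\<O> c = Z \<oplus> (F \<union> (set_decode c \<inter> X))" for c
  let ?S = "{n. \<exists>c a. eval (\<O> c) p [n, a] 1}"
  have mem: "x \<in> \<O> c \<longleftrightarrow>
      (if odd x then x div 2 \<in> F \<or> x div 2 \<in> set_decode c \<and> x div 2 \<in> X else x div 2 \<in> Z)" for x c
    by (simp add: \<O>_def mem_join)
  have half: "computable Z 2 (\<lambda>xs. xs ! 1 div 2)"
    by (intro computable_half computable_nth) simp
  have "Sigma1 Z ?S"
    by (rule Sigma1_oracle_family, unfold mem)
      (intro computable_in_if computable_in_odd computable_in_disj computable_in_conj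
        computable_in_finite[OF F half] computable_in_set_decode computable_in_oracle half
        computable_in_unary[OF comp half] computable_nth; simp)
  with B have "?S \<noteq> B" by metis
  moreover have "?S \<subseteq> B"
  proof clarify
    fix n c a assume "eval (\<O> c) p [n, a] 1"
    moreover have "finite (set_decode c \<inter> X)" "set_decode c \<inter> X \<subseteq> X" by auto
    ultimately show "n \<in> B" using False unfolding \<O>_def by metis
  qed
  ultimately obtain n where n: "n \<in> B" "n \<notin> ?S" by (meson psubsetI psubset_imp_ex_mem DiffE)
  have "\<not> eval (Z \<oplus> C) p [n, a] 1" if C: "F \<subseteq> C" "C \<subseteq> F \<union> X" for C a
  proof
    assume "eval (Z \<oplus> C) p [n, a] 1"
    then obtain u where u: "\<And>Y. Y \<inter> {..<u} = C \<inter> {..<u} \<Longrightarrow> eval (Z \<oplus> Y) p [n, a] 1"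
      by (rule eval_join_use) blast
    \<comment> \<open>The part of \<open>C\<close> below the use is finite, so it has a code and
      would already put \<open>n\<close> into \<open>?S\<close>.\<close>
    have "eval (\<O> (set_encode (C \<inter> X \<inter> {..<u}))) p [n, a] 1"
      unfolding \<O>_def by (rule u) (use C in \<open>auto simp: set_encode_inverse\<close>)
    with n(2) show False by blast
  qed
  with n(1) have "\<forall>C. F \<subseteq> C \<and> C \<subseteq> F \<union> X \<longrightarrow> B \<noteq> {n. \<exists>a. eval (Z \<oplus> C) p [n, a] 1}"
    by blast
  with F X comp show ?thesis by blast
qed

text \<open>Allowing any countable family serves both claims: a given sequence, and the sets
  obtained from \<open>Sigma2\<close> definitions over \<open>Z\<close>.\<close>

lemma cohesive_avoiding_Sigma1:
  assumes A: "computable_seq Z A" and "countable \<B>" and \<B>: "\<And>B. B \<in> \<B> \<Longrightarrow> \<not> Sigma1 Z B"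
  obtains C where "cohesive A C" and "\<And>B. B \<in> \<B> \<Longrightarrow> \<not> Sigma1 (Z \<oplus> C) B"
proof -
  define cond where
    "cond F X \<longleftrightarrow> finite F \<and> infinite X \<and> computable_in Z 1 (\<lambda>xs. xs ! 0 \<in> X)"
    for F X :: "nat set"
  \<comment> \<open>Meeting all \<open>large k\<close> makes \<open>C\<close> infinite,
    \<open>decided\<close> gives cohesiveness, and \<open>avoid\<close> excludes one program as an
    enumeration of one set.\<close>
  define large where "large k = {C. \<exists>x\<in>C. k \<le> x}" for k :: nat
  define decided where "decided k = {C. finite (C - A k) \<or> finite (C \<inter> A k)}" for k
  define avoid where "avoid = (\<lambda>(B, p). {C. B \<noteq> {n. \<exists>a. eval (Z \<oplus> C) p [n, a] 1}})"
  let ?Q = "range large \<union> range decided \<union> avoid ` (\<B> \<times> UNIV)"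
  have "cond {} UNIV" by (simp add: cond_def computable_in_const)
  moreover have "countable ?Q" using \<open>countable \<B>\<close> by simp
  moreover have "\<exists>F' X'. cond F' X' \<and> F \<subseteq> F' \<and> F' \<subseteq> F \<union> X \<and> X' \<subseteq> X \<and>
      (\<forall>C. F' \<subseteq> C \<and> C \<subseteq> F' \<union> X' \<longrightarrow> C \<in> Q)" if "Q \<in> ?Q" and FX: "cond F X" for Q F X
    using \<open>Q \<in> ?Q\<close>
  proof (elim UnE imageE)
    fix k assume Q: "Q = large k"
    from FX obtain x where "x \<in> X" "k \<le> x"
      by (auto simp: cond_def infinite_nat_iff_unbounded_le)
    with Q FX show ?thesis
      by (intro exI[of _ "insert x F"] exI[of _ X]) (auto simp: cond_def large_def)
  next
    fix k assume Q: "Q = decided k"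
    have Ak: "computable_in Z 1 (\<lambda>xs. xs ! 0 \<in> A k)"
      using computable_comp[of Z "[\<lambda>_. k, \<lambda>xs. xs ! 0]" "\<lambda>xs. if xs ! 1 \<in> A (xs ! 0) then 1 else 0" 1] A
      by (simp add: computable_seq_def computable_in_iff numeral_2_eq_2 computable_const computable_nth)
    \<comment> \<open>The stem is kept. Elements outside it come from \<open>Y\<close>, which lies
      on one side of \<open>A k\<close>, so \<open>C\<close> meets the other side only within the
      finite \<open>F\<close>.\<close>
    have refine: ?thesis
      if Y: "Y \<subseteq> X" "cond F Y" and dec: "\<And>C. C \<subseteq> F \<union> Y \<Longrightarrow> C - A k \<subseteq> F \<or> C \<inter> A k \<subseteq> F" for Y
    proof (intro exI conjI allI impI)
      fix C assume "F \<subseteq> C \<and> C \<subseteq> F \<union> Y"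
      with dec[of C] FX show "C \<in> Q"
        unfolding Q decided_def cond_def mem_Collect_eq by (metis finite_subset)
    qed (use Y in simp_all)
    from FX have "infinite (X \<inter> A k) \<or> infinite (X - A k)"
      unfolding cond_def by (metis Un_Diff_Int finite_Un)
    then show ?thesis
    proof
      assume "infinite (X \<inter> A k)"
      with FX Ak have "cond F (X \<inter> A k)" by (simp add: cond_def computable_in_conj)
      then show ?thesis by (rule refine[rotated]) blast+
    next
      assume "infinite (X - A k)"
      with FX Ak have "cond F (X - A k)" by (simp add: cond_def computable_in_conj computable_in_not)
      then show ?thesis by (rule refine[rotated]) blast+
    qed
  next
    fix r assume "Q = avoid r" "r \<in> \<B> \<times> UNIV"
    then obtain B p where "B \<in> \<B>" and Q: "Q = {C. B \<noteq> {n. \<exists>a. eval (Z \<oplus> C) p [n, a] 1}}"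
      by (auto simp: avoid_def)
    from FX have "finite F" "infinite X" "computable_in Z 1 (\<lambda>xs. xs ! 0 \<in> X)"
      by (simp_all add: cond_def)
    from extension_avoiding_Sigma1[OF \<B>[OF \<open>B \<in> \<B>\<close>] this] show ?thesis
      unfolding cond_def Q mem_Collect_eq .
  qed
  ultimately have "\<exists>C. \<forall>Q\<in>?Q. C \<in> Q" by (rule generic_exists)
  then obtain C where C: "\<forall>Q\<in>?Q. C \<in> Q" ..
  show thesis
  proof (rule that)
    have "\<exists>x\<in>C. k \<le> x" for k using bspec[OF C, of "large k"] by (simp add: large_def)
    moreover have "finite (C - A k) \<or> finite (C \<inter> A k)" for k
      using bspec[OF C, of "decided k"] by (simp add: decided_def)
    ultimately show "cohesive A C"
      unfolding cohesive_def infinite_nat_iff_unbounded_le by blast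
    fix B assume "B \<in> \<B>"
    show "\<not> Sigma1 (Z \<oplus> C) B"
    proof
      assume "Sigma1 (Z \<oplus> C) B"
      then obtain R where R: "computable_in (Z \<oplus> C) 2 R" and B: "B = {n. \<exists>a. R [n, a]}"
        by (auto simp: Sigma1_def)
      from R obtain p where "\<And>xs. length xs = 2 \<Longrightarrow> R xs \<longleftrightarrow> eval (Z \<oplus> C) p xs 1"
        by (rule computable_in_eval) blast
      with B have "B = {n. \<exists>a. eval (Z \<oplus> C) p [n, a] 1}" by simp
      moreover have "C \<in> avoid (B, p)" by (rule bspec[OF C]) (simp add: \<open>B \<in> \<B>\<close>)
      ultimately show False by (simp add: avoid_def)
    qed
  qed
qed

theorem theorem3p15:
  "(\<forall>(Z :: nat set) (A :: nat \<Rightarrow> nat set) (B :: nat \<Rightarrow> nat set).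
      computable_seq Z A \<and> (\<forall>i. \<not> Sigma1 Z (B i)) \<longrightarrow>
      (\<exists>C. cohesive A C \<and> (\<forall>i. \<not> Sigma1 (Z \<oplus> C) (B i)))) \<and>
   (\<forall>(Z :: nat set) (A :: nat \<Rightarrow> nat set).
      computable_seq Z A \<longrightarrow> (\<exists>C. cohesive A C \<and> preserves_Delta2 Z C))"
proof (intro conjI allI impI)
  fix Z and A B :: "nat \<Rightarrow> nat set"
  assume "computable_seq Z A \<and> (\<forall>i. \<not> Sigma1 Z (B i))"
  then have A: "computable_seq Z A" and B: "\<And>b. b \<in> range B \<Longrightarrow> \<not> Sigma1 Z b" by auto
  obtain C where "cohesive A C" "\<And>b. b \<in> range B \<Longrightarrow> \<not> Sigma1 (Z \<oplus> C) b"
    by (rule cohesive_avoiding_Sigma1[OF A _ B]) auto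
  then show "\<exists>C. cohesive A C \<and> (\<forall>i. \<not> Sigma1 (Z \<oplus> C) (B i))" by blast
next
  fix Z and A :: "nat \<Rightarrow> nat set"
  assume A: "computable_seq Z A"
  \<comment> \<open>The family is countable and contains both \<open>B\<close> and
    \<open>- B\<close> for every properly \<open>Delta2\<close> set \<open>B\<close>; the
    complements take care of \<open>Pi1\<close> definitions.\<close>
  let ?D = "{B. Sigma2 Z B}"
  let ?B = "{B \<in> ?D \<union> uminus ` ?D. \<not> Sigma1 Z B}"
  have "countable ?B"
    by (rule countable_subset[of _ "?D \<union> uminus ` ?D"]) (auto simp: countable_Sigma2)
  then obtain C where "cohesive A C" and C: "\<And>B. B \<in> ?B \<Longrightarrow> \<not> Sigma1 (Z \<oplus> C) B"
    by (rule cohesive_avoiding_Sigma1[OF A]) blast+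
  have "properly_Delta2 (Z \<oplus> C) B" if "properly_Delta2 Z B" for B
  proof -
    from that have "Delta2 Z B" "\<not> Sigma1 Z B" "\<not> Sigma1 Z (- B)"
      by (auto simp: properly_Delta2_def dest: Sigma1_uminus)
    moreover from this have "B \<in> ?B" "- B \<in> ?B" by (auto simp: Delta2_def)
    ultimately show ?thesis
      using C[of B] C[of "- B"] by (auto simp: properly_Delta2_def intro: Delta2_join dest: Pi1_uminus)
  qed
  with \<open>cohesive A C\<close> show "\<exists>C. cohesive A C \<and> preserves_Delta2 Z C"
    by (auto simp: preserves_Delta2_def)
qed

end
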